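(* Let $\Omega\subset\mathbb{R}^3$ be open, $1\le p\le\infty$, $\boldsymbol F\in\mathscr{CM}^p(\Omega)$, and let $U\Subset\Omega$ be open and bounded. Then: (a) $C_c^\infty(\Omega)\ni\varphi\mapsto\langle(\boldsymbol F\times\nu)_U^{\mathrm{int}},\varphi\rangle_{\partial U}$ is an $\mathbb{R}^3$-valued distribution supported on $\partial U$ of order at most one. (b) $C_c^\infty(\Omega;\mathbb{R}^3)\ni\boldsymbol\varphi\mapsto\langle(\boldsymbol F\times\nu)_U^{\mathrm{int}},\boldsymbol\varphi\rangle_{\partial U}$ is a distribution supported on $\partial U$ of order at most one. The analogous assertions hold for $\langle(\boldsymbol F\times\nu)_U^{\mathrm{ext}},\cdot\rangle_{\partial U}$ (on scalar and on vector-valued test functions).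
   Context: $\mathscr{CM}^p(\Omega)$ is the space of all $\boldsymbol F\in L^p(\Omega;\mathbb{R}^3)$ whose distributional curl is a finite $\mathbb{R}^3$-valued Radon measure on $\Omega$. For $\varphi\in C_c^\infty(\Omega)$ the interior and exterior tangential traces on $\partial U$ are the $\mathbb{R}^3$-valued functionals $$\langle(\boldsymbol F\times\nu)_U^{\mathrm{int}},\varphi\rangle_{\partial U}:=\int_U\varphi\,d(\operatorname{curl}\boldsymbol F)-\int_U\boldsymbol F\times\nabla\varphi\,dx,$$ $$\langle(\boldsymbol F\times\nu)_U^{\mathrm{ext}},\varphi\rangle_{\partial U}:=-\int_{\Omega\setminus\overline U}\varphi\,d(\operatorname{curl}\boldsymbol F)+\int_{\Omega\setminus\overline U}\boldsymbol F\times\nabla\varphi\,dx.$$ For $\boldsymbol\varphi=(\varphi_1,\varphi_2,\varphi_3)\in C_c^\infty(\Omega;\mathbb{R}^3)$ one sets $\langle(\boldsymbol F\times\nu)_U^{\mathrm{int}},\boldsymbol\varphi\rangle_{\partial U}:=\sum_{i=1}^3\langle(\boldsymbol F\times\nu)_{U,i}^{\mathrm{int}},\varphi_i\rangle_{\partial U}=\int_U\boldsymbol\varphi\cdot d(\operatorname{curl}\boldsymbol F)-\int_U\boldsymbol F\cdot\operatorname{curl}\boldsymbol\varphi\,dx$, where the index $i$ denotes the $i$-th component; likewise $\langle(\boldsymbol F\times\nu)_U^{\mathrm{ext}},\boldsymbol\varphi\rangle_{\partial U}=-\int_{\Omega\setminus\overline U}\boldsymbol\varphi\cdot d(\operatorname{curl}\boldsymbol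 F)+\int_{\Omega\setminus\overline U}\boldsymbol F\cdot\operatorname{curl}\boldsymbol\varphi\,dx$. *)

theory Defs
  imports "HOL-Analysis.Analysis"
begin

section \<open>Test functions\<close>

definition partial :: "3 \<Rightarrow> (real^3 \<Rightarrow> 'a::real_normed_vector) \<Rightarrow> real^3 \<Rightarrow> 'a" where
  "partial i f x = frechet_derivative f (at x) (axis i 1)"

definition grad :: "(real^3 \<Rightarrow> real) \<Rightarrow> real^3 \<Rightarrow> real^3" where
  "grad f x = (\<chi> i. partial i f x)"

primrec C_k :: "nat \<Rightarrow> (real^3 \<Rightarrow> 'a::real_normed_vector) \<Rightarrow> bool" where
  "C_k 0 f \<longleftrightarrow> continuous_on UNIV f"
| "C_k (Suc k) f \<longleftrightarrow> (\<forall>x. f differentiable (at x)) \<and> (\<forall>i. C_k k (partial i f))"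

definition supp :: "(real^3 \<Rightarrow> 'a::real_normed_vector) \<Rightarrow> (real^3) set" where
  "supp f = closure {x. f x \<noteq> 0}"

text \<open>Elements of \<open>C\<^sub>c\<^sup>\<infinity>(\<Omega>)\<close> are identified with their extensions by zero to the whole space;
  \<^typ>\<open>'a\<close> is instantiated with \<^typ>\<open>real\<close> or \<^typ>\<open>real^3\<close>.\<close>

definition test_functions :: "(real^3) set \<Rightarrow> (real^3 \<Rightarrow> 'a::real_normed_vector) set" where
  "test_functions \<Omega> = {\<phi>. (\<forall>k. C_k k \<phi>) \<and> compact (supp \<phi>) \<and> supp \<phi> \<subseteq> \<Omega>}"


section \<open>Distributions\<close>

definition multi_deriv :: "nat^3 \<Rightarrow> (real^3 \<Rightarrow> 'a::real_normed_vector) \<Rightarrow> real^3 \<Rightarrow> 'a" where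
  "multi_deriv \<alpha> f = (partial 1 ^^ (\<alpha>$1)) ((partial 2 ^^ (\<alpha>$2)) ((partial 3 ^^ (\<alpha>$3)) f))"

text \<open>The supremum is taken over the whole space rather than over a compact set \<open>K\<close>. For functions
  supported in \<open>K\<close> this is the same number, and it avoids \<open>Sup {}\<close> when \<open>K\<close> is empty.\<close>

definition C_k_norm :: "nat \<Rightarrow> (real^3 \<Rightarrow> 'a::real_normed_vector) \<Rightarrow> real" where
  "C_k_norm k \<phi> = (\<Sum>\<alpha> | (\<Sum>i\<in>UNIV. \<alpha>$i) \<le> k. SUP x. norm (multi_deriv \<alpha> \<phi> x))"

definition linear_on_tests ::
    "(real^3) set \<Rightarrow> ((real^3 \<Rightarrow> 'a::real_normed_vector) \<Rightarrow> 'b::real_normed_vector) \<Rightarrow> bool" where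
  "linear_on_tests \<Omega> T \<longleftrightarrow>
     (\<forall>\<phi>\<in>test_functions \<Omega>. \<forall>\<psi>\<in>test_functions \<Omega>. T (\<lambda>x. \<phi> x + \<psi> x) = T \<phi> + T \<psi>) \<and>
     (\<forall>c. \<forall>\<phi>\<in>test_functions \<Omega>. T (\<lambda>x. c *\<^sub>R \<phi> x) = c *\<^sub>R T \<phi>)"

definition distribution ::
    "(real^3) set \<Rightarrow> ((real^3 \<Rightarrow> 'a::real_normed_vector) \<Rightarrow> 'b::real_normed_vector) \<Rightarrow> bool" where
  "distribution \<Omega> T \<longleftrightarrow> linear_on_tests \<Omega> T \<and>
     (\<forall>K. compact K \<and> K \<subseteq> \<Omega> \<longrightarrow>
        (\<exists>N C. \<forall>\<phi>\<in>test_functions \<Omega>. supp \<phi> \<subseteq> K \<longrightarrow> norm (T \<phi>) \<le> C * C_k_norm N \<phi>))"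

definition order_at_most ::
    "(real^3) set \<Rightarrow> ((real^3 \<Rightarrow> 'a::real_normed_vector) \<Rightarrow> 'b::real_normed_vector) \<Rightarrow> nat \<Rightarrow> bool" where
  "order_at_most \<Omega> T N \<longleftrightarrow>
     (\<forall>K. compact K \<and> K \<subseteq> \<Omega> \<longrightarrow>
        (\<exists>C. \<forall>\<phi>\<in>test_functions \<Omega>. supp \<phi> \<subseteq> K \<longrightarrow> norm (T \<phi>) \<le> C * C_k_norm N \<phi>))"

definition dist_support ::
    "(real^3) set \<Rightarrow> ((real^3 \<Rightarrow> 'a::real_normed_vector) \<Rightarrow> 'b::real_normed_vector) \<Rightarrow> (real^3) set" where
  "dist_support \<Omega> T = \<Omega> - \<Union>{V. open V \<and> V \<subseteq> \<Omega> \<and> (\<forall>\<phi>\<in>test_functions V. T \<phi> = 0)}"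


section \<open>Finite vector-valued Radon measures\<close>

text \<open>On an open subset of \<^typ>\<open>real^3\<close> these are exactly the countably additive set functions
  on the Borel sets; their total variation is then automatically finite and regular.
  Values on sets that are not Borel subsets of \<open>\<Omega>\<close> are irrelevant.\<close>

definition finite_radon_measure :: "(real^3) set \<Rightarrow> ((real^3) set \<Rightarrow> real^3) \<Rightarrow> bool" where
  "finite_radon_measure \<Omega> \<mu> \<longleftrightarrow>
     (\<forall>A::nat \<Rightarrow> (real^3) set. range A \<subseteq> sets (restrict_space borel \<Omega>) \<and> disjoint_family A \<longrightarrow>
        (\<lambda>n. \<mu> (A n)) sums \<mu> (\<Union>n. A n))"

text \<open>The positive part \<open>\<mu>\<^sup>+\<close> in the Jordan decomposition of a signed measure; the negative part is
  \<open>(-\<mu>)\<^sup>+\<close>. Negative values \<open>\<mu> B\<close> are truncated by \<^const>\<open>ennreal\<close>, which does not matter because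
  \<open>B = {}\<close> is admissible.\<close>

definition positive_part :: "'a measure \<Rightarrow> ('a set \<Rightarrow> real) \<Rightarrow> 'a measure" where
  "positive_part M \<mu> =
     measure_of (space M) (sets M) (\<lambda>A. SUP B\<in>{B\<in>sets M. B \<subseteq> A}. ennreal (\<mu> B))"

definition signed_integral :: "'a measure \<Rightarrow> ('a set \<Rightarrow> real) \<Rightarrow> 'a set \<Rightarrow> ('a \<Rightarrow> real) \<Rightarrow> real" where
  "signed_integral M \<mu> A f =
     (LINT x:A|positive_part M \<mu>. f x) - (LINT x:A|positive_part M (\<lambda>B. - \<mu> B). f x)"

definition radon_integral ::
    "(real^3) set \<Rightarrow> ((real^3) set \<Rightarrow> real^3) \<Rightarrow> (real^3) set \<Rightarrow> (real^3 \<Rightarrow> real) \<Rightarrow> real^3" where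
  "radon_integral \<Omega> \<mu> A f =
     (\<chi> i. signed_integral (restrict_space borel \<Omega>) (\<lambda>B. \<mu> B $ i) A f)"


section \<open>Fields whose curl is a measure\<close>

text \<open>Functions instead of equivalence classes modulo null sets.\<close>

definition Lp :: "ennreal \<Rightarrow> (real^3) set \<Rightarrow> (real^3 \<Rightarrow> real^3) set" where
  "Lp p \<Omega> = {F \<in> borel_measurable (lebesgue_on \<Omega>).
     if p = \<infinity> then \<exists>C. AE x in lebesgue_on \<Omega>. norm (F x) \<le> C
     else integrable (lebesgue_on \<Omega>) (\<lambda>x. norm (F x) powr enn2real p)}"

text \<open>Componentwise this is the usual definition, e.g.
  \<open>\<langle>\<partial>\<^sub>2 F\<^sub>3 - \<partial>\<^sub>3 F\<^sub>2, \<phi>\<rangle> = \<integral> (F\<^sub>2 \<partial>\<^sub>3 \<phi> - F\<^sub>3 \<partial>\<^sub>2 \<phi>)\<close>.\<close>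

definition distributional_curl ::
    "(real^3) set \<Rightarrow> (real^3 \<Rightarrow> real^3) \<Rightarrow> (real^3 \<Rightarrow> real) \<Rightarrow> real^3" where
  "distributional_curl \<Omega> F \<phi> = (LINT x:\<Omega>|lebesgue. cross3 (F x) (grad \<phi> x))"

definition is_curl_measure ::
    "(real^3) set \<Rightarrow> (real^3 \<Rightarrow> real^3) \<Rightarrow> ((real^3) set \<Rightarrow> real^3) \<Rightarrow> bool" where
  "is_curl_measure \<Omega> F \<mu> \<longleftrightarrow> finite_radon_measure \<Omega> \<mu> \<and>
     (\<forall>\<phi>\<in>test_functions \<Omega>. radon_integral \<Omega> \<mu> \<Omega> \<phi> = distributional_curl \<Omega> F \<phi>)"

definition CM :: "ennreal \<Rightarrow> (real^3) set \<Rightarrow> (real^3 \<Rightarrow> real^3) set" where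
  "CM p \<Omega> = {F \<in> Lp p \<Omega>. \<exists>\<mu>. is_curl_measure \<Omega> F \<mu>}"

text \<open>The choice only affects sets that are not Borel subsets of \<open>\<Omega>\<close>: on Borel subsets the
  measure is determined by its integrals against test functions.\<close>

definition curl_measure :: "(real^3) set \<Rightarrow> (real^3 \<Rightarrow> real^3) \<Rightarrow> (real^3) set \<Rightarrow> real^3" where
  "curl_measure \<Omega> F = (SOME \<mu>. is_curl_measure \<Omega> F \<mu>)"


section \<open>Tangential traces\<close>

definition trace_int ::
    "(real^3) set \<Rightarrow> (real^3 \<Rightarrow> real^3) \<Rightarrow> (real^3) set \<Rightarrow> (real^3 \<Rightarrow> real) \<Rightarrow> real^3" where
  "trace_int \<Omega> F U \<phi> =
     radon_integral \<Omega> (curl_measure \<Omega> F) U \<phi>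
     - (LINT x:U|lebesgue. cross3 (F x) (grad \<phi> x))"

definition trace_ext ::
    "(real^3) set \<Rightarrow> (real^3 \<Rightarrow> real^3) \<Rightarrow> (real^3) set \<Rightarrow> (real^3 \<Rightarrow> real) \<Rightarrow> real^3" where
  "trace_ext \<Omega> F U \<phi> =
     - radon_integral \<Omega> (curl_measure \<Omega> F) (\<Omega> - closure U) \<phi>
     + (LINT x:(\<Omega> - closure U)|lebesgue. cross3 (F x) (grad \<phi> x))"

text \<open>For the vector-valued test functions, \<open>\<Sum>\<^sub>i (F \<times> \<nabla>\<phi>\<^sub>i)\<^sub>i = F \<bullet> curl \<phi>\<close>, so the sums below are
  \<open>\<integral>\<^sub>U \<phi> \<bullet> d(curl F) - \<integral>\<^sub>U F \<bullet> curl \<phi>\<close> and minus the same expression over \<open>\<Omega> - closure U\<close>.\<close>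

definition trace_int_vec ::
    "(real^3) set \<Rightarrow> (real^3 \<Rightarrow> real^3) \<Rightarrow> (real^3) set \<Rightarrow> (real^3 \<Rightarrow> real^3) \<Rightarrow> real" where
  "trace_int_vec \<Omega> F U \<phi> = (\<Sum>i\<in>UNIV. trace_int \<Omega> F U (\<lambda>x. \<phi> x $ i) $ i)"

definition trace_ext_vec ::
    "(real^3) set \<Rightarrow> (real^3 \<Rightarrow> real^3) \<Rightarrow> (real^3) set \<Rightarrow> (real^3 \<Rightarrow> real^3) \<Rightarrow> real" where
  "trace_ext_vec \<Omega> F U \<phi> = (\<Sum>i\<in>UNIV. trace_ext \<Omega> F U (\<lambda>x. \<phi> x $ i) $ i)"

end

theory Submission
  imports Defs
begin

text \<open>
  All four functionals are built from one. For an open \<open>S \<subseteq> \<Omega>\<close> and \<open>\<mu> = curl F\<close> put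
  \<open>G\<^sub>S \<phi> = \<integral>\<^sub>S \<phi> d\<mu> - \<integral>\<^sub>S F \<times> \<nabla>\<phi>\<close> (\<open>interior_trace\<close> below). With \<open>W = \<Omega> - closure U\<close>,
  the interior trace of \<open>U\<close> is \<open>G\<^sub>U\<close>, the exterior one is \<open>- G\<^sub>W\<close>, and the functionals on
  vector fields are the sums of the components, the \<open>i\<close>-th component being tested against \<open>\<phi>\<^sub>i\<close>.

  \<^emph>\<open>Order.\<close> A finite measure gives
  \<open>\<bar>\<integral>\<^sub>S \<phi> d\<mu>\<^sub>i\<bar> \<le> (\<mu>\<^sub>i\<^sup>+(\<Omega>) + \<mu>\<^sub>i\<^sup>-(\<Omega>)) sup \<bar>\<phi>\<bar>\<close>, and if \<open>\<phi>\<close> is supported in the compact set \<open>K\<close>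
  then \<open>\<bar>\<integral>\<^sub>S F \<times> \<nabla>\<phi>\<bar> \<le> (\<integral>\<^sub>K \<bar>F\<bar>) sup \<bar>\<nabla>\<phi>\<bar>\<close>, where \<open>\<integral>\<^sub>K \<bar>F\<bar>\<close> is finite because \<open>L\<^sup>p\<close> functions
  are locally integrable for \<open>p \<ge> 1\<close>. Only values and first derivatives of \<open>\<phi>\<close> enter, hence order
  at most one (\<open>order_at_most_interior_trace\<close>). The substantial point is that \<open>\<mu>\<^sub>i\<^sup>\<plusminus>(\<Omega>)\<close> is finite
  although \<open>\<mu>\<close> is only given as a countably additive set function; this is the classical theorem
  that a real-valued signed measure is bounded (\<open>signed_measure.bounded\<close>).

  \<^emph>\<open>Support.\<close> The complement of \<open>frontier U\<close> in \<open>\<Omega>\<close> is the disjoint union of the open sets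
  \<open>U\<close> and \<open>W\<close>. Let \<open>\<phi>\<close> be supported in one of them. Either \<open>\<phi>\<close> vanishes on \<open>S\<close>, and then
  trivially \<open>G\<^sub>S \<phi> = 0\<close>, or \<open>\<phi>\<close> is supported in \<open>S\<close>. In the second case both integrals
  over \<open>S\<close> equal the integrals over \<open>\<Omega>\<close>, and these agree by the definition of the distributional
  curl (\<open>interior_trace_inside\<close>).
\<close>

section \<open>Boundedness of signed measures\<close>

locale signed_measure =
  fixes M :: "'a measure" and \<nu> :: "'a set \<Rightarrow> real"
  assumes countably_additive:
    "\<And>A::nat \<Rightarrow> 'a set. range A \<subseteq> sets M \<Longrightarrow> disjoint_family A \<Longrightarrow> (\<lambda>n. \<nu> (A n)) sums \<nu> (\<Union>n. A n)"
begin

lemma empty: "\<nu> {} = 0"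
proof -
  have "(\<lambda>n::nat. \<nu> {}) sums \<nu> {}"
    using countably_additive[of "\<lambda>_. {}"] by (simp add: disjoint_family_on_def)
  then show ?thesis
    using summable_const_iff[of "\<nu> {}"] by (auto simp: sums_iff)
qed

lemma Un_disjoint:
  assumes "A \<in> sets M" "B \<in> sets M" "A \<inter> B = {}"
  shows "\<nu> (A \<union> B) = \<nu> A + \<nu> B"
proof -
  have "(\<lambda>n. \<nu> (binaryset A B n)) sums \<nu> (\<Union>n. binaryset A B n)"
    using assms by (intro countably_additive) (auto simp: range_binaryset_eq disjoint_family_on_def binaryset_def)
  moreover have "(\<lambda>n. \<nu> (binaryset A B n)) sums (\<nu> A + \<nu> B)"
    by (rule binaryset_sums) (rule empty)
  ultimately show ?thesis
    by (simp add: UN_binaryset_eq sums_unique2)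
qed

lemma Diff:
  assumes "A \<in> sets M" "B \<in> sets M" "B \<subseteq> A"
  shows "\<nu> (A - B) = \<nu> A - \<nu> B"
proof -
  have "\<nu> ((A - B) \<union> B) = \<nu> (A - B) + \<nu> B"
    using assms by (intro Un_disjoint sets.Diff) auto
  moreover have "(A - B) \<union> B = A" using assms by blast
  ultimately show ?thesis by simp
qed

text \<open>Boundedness of the values on all measurable subsets of \<open>E\<close>, so that it can be
  passed on from two pieces to their union.\<close>

definition bounded_on :: "'a set \<Rightarrow> bool" where
  "bounded_on E \<longleftrightarrow> (\<exists>C. \<forall>B\<in>sets M. B \<subseteq> E \<longrightarrow> \<bar>\<nu> B\<bar> \<le> C)"

lemma bounded_on_decompose:
  assumes E: "E \<in> sets M" and B: "B \<in> sets M"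
    and "bounded_on B" "bounded_on (E - B)"
  shows "bounded_on E"
proof -
  obtain C D where C: "\<And>A. A \<in> sets M \<Longrightarrow> A \<subseteq> B \<Longrightarrow> \<bar>\<nu> A\<bar> \<le> C"
    and D: "\<And>A. A \<in> sets M \<Longrightarrow> A \<subseteq> E - B \<Longrightarrow> \<bar>\<nu> A\<bar> \<le> D"
    using assms(3,4) unfolding bounded_on_def by metis
  have "\<bar>\<nu> A\<bar> \<le> C + D" if A: "A \<in> sets M" "A \<subseteq> E" for A
  proof -
    have "\<nu> A = \<nu> (A \<inter> B) + \<nu> (A - B)"
      using Un_disjoint[of "A \<inter> B" "A - B"] A B by (simp add: Int_Diff_Un Int_Diff_disjoint sets.Int sets.Diff)
    moreover have "\<bar>\<nu> (A \<inter> B)\<bar> \<le> C" "\<bar>\<nu> (A - B)\<bar> \<le> D"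
      using A B by (auto intro!: C D)
    ultimately show ?thesis by linarith
  qed
  then show ?thesis unfolding bounded_on_def by blast
qed

text \<open>Cut \<open>E\<close> along a measurable \<open>B\<close> whose value is so large that the value of \<open>E - B\<close> is large
  too. At least one of the two pieces is still unbounded; keep that one, and the discarded
  piece has absolute value at least 1 in either case.\<close>

lemma unbounded_subset:
  assumes E: "E \<in> sets M" "\<not> bounded_on E"
  obtains E' where "E' \<in> sets M" "\<not> bounded_on E'" "E' \<subseteq> E" "\<bar>\<nu> (E - E')\<bar> \<ge> 1"
proof -
  obtain B where B: "B \<in> sets M" "B \<subseteq> E" "\<bar>\<nu> B\<bar> > \<bar>\<nu> E\<bar> + 1"
    using E unfolding bounded_on_def by (meson not_le)
  then have "\<bar>\<nu> (E - B)\<bar> \<ge> 1"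
    using Diff[OF E(1), of B] by linarith
  moreover have "E - (E - B) = B" using B by auto
  moreover have "\<not> bounded_on B \<or> \<not> bounded_on (E - B)"
    using bounded_on_decompose E B by blast
  moreover have "\<bar>\<nu> B\<bar> \<ge> 1" using B(3) by linarith
  ultimately show ?thesis
    using that[of B] that[of "E - B"] B(1,2) E(1) by (metis Diff_subset sets.Diff)
qed

text \<open>Otherwise the preceding step can be iterated forever. The discarded pieces are disjoint and
  have absolute value at least 1, so the series of their values diverges, contrary to
  countable additivity.\<close>

lemma bounded: "\<exists>C. \<forall>B\<in>sets M. \<bar>\<nu> B\<bar> \<le> C"
proof (rule ccontr)
  assume unbounded: "\<nexists>C. \<forall>B\<in>sets M. \<bar>\<nu> B\<bar> \<le> C"
  have "\<not> bounded_on (space M)"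
  proof
    assume "bounded_on (space M)"
    then obtain C where C: "\<forall>B\<in>sets M. B \<subseteq> space M \<longrightarrow> \<bar>\<nu> B\<bar> \<le> C"
      unfolding bounded_on_def ..
    have "\<bar>\<nu> B\<bar> \<le> C" if "B \<in> sets M" for B
      using C that sets.sets_into_space[OF that] by simp
    with unbounded show False by blast
  qed
  then have "\<exists>E. \<forall>n::nat. (E n \<in> sets M \<and> \<not> bounded_on (E n)) \<and>
      (E (Suc n) \<subseteq> E n \<and> \<bar>\<nu> (E n - E (Suc n))\<bar> \<ge> 1)"
  proof (intro dependent_nat_choice)
    fix E assume "E \<in> sets M \<and> \<not> bounded_on E"
    then obtain E' where "E' \<in> sets M" "\<not> bounded_on E'" "E' \<subseteq> E" "\<bar>\<nu> (E - E')\<bar> \<ge> 1"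
      using unbounded_subset by metis
    then show "\<exists>E'. (E' \<in> sets M \<and> \<not> bounded_on E') \<and> (E' \<subseteq> E \<and> \<bar>\<nu> (E - E')\<bar> \<ge> 1)"
      by blast
  qed auto
  then obtain E where E: "\<And>n::nat. E n \<in> sets M" "\<And>n. E (Suc n) \<subseteq> E n"
      "\<And>n. \<bar>\<nu> (E n - E (Suc n))\<bar> \<ge> 1"
    by blast
  \<comment> \<open>\<open>disjoint_family_Suc\<close> is about increasing sequences, hence the complements.\<close>
  have "disjoint_family (\<lambda>n. (- E (Suc n)) - (- E n))"
    by (rule disjoint_family_Suc) (use E(2) in auto)
  then have "disjoint_family (\<lambda>n. E n - E (Suc n))"
    by (simp add: Diff_eq Int_commute)
  then have "(\<lambda>n. \<nu> (E n - E (Suc n))) sums \<nu> (\<Union>n. E n - E (Suc n))"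
    using E(1) by (intro countably_additive) auto
  then have "(\<lambda>n. \<nu> (E n - E (Suc n))) \<longlonglongrightarrow> 0"
    using summable_LIMSEQ_zero sums_summable by blast
  from tendstoD[OF this zero_less_one]
  obtain n where "dist (\<nu> (E n - E (Suc n))) 0 < 1"
    using eventually_happens'[OF sequentially_bot] by blast
  with E(3)[of n] show False by (simp add: dist_real_def)
qed

text \<open>A measure produced by \<^const>\<open>measure_of\<close> takes on each set either the value of the given set
  function or 0. Both are at most the bound on the signed measure, so the estimate does not pass
  through the Jordan decomposition theorem.\<close>

lemma finite_measure_positive_part: "finite_measure (positive_part M \<nu>)"
proof
  obtain C where C: "\<And>B. B \<in> sets M \<Longrightarrow> \<bar>\<nu> B\<bar> \<le> C" using bounded by blast
  have le: "(SUP B\<in>{B \<in> sets M. B \<subseteq> A}. ennreal (\<nu> B)) \<le> ennreal C" for A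
    using C by (intro SUP_least ennreal_leI) (auto simp: abs_le_iff)
  have "emeasure (positive_part M \<nu>) A \<le> ennreal C" for A
    unfolding positive_part_def using le[of A]
    by (simp add: emeasure_measure_of_conv)
  from le_less_trans[OF this[of "space (positive_part M \<nu>)"] ennreal_less_top]
  show "emeasure (positive_part M \<nu>) (space (positive_part M \<nu>)) \<noteq> \<infinity>"
    by simp
qed

lemma uminus: "signed_measure M (\<lambda>B. - \<nu> B)"
  by unfold_locales (intro sums_minus countably_additive)

end

lemma sets_positive_part [simp, measurable_cong]: "sets (positive_part M \<nu>) = sets M"
  unfolding positive_part_def by simp

lemma space_positive_part [simp]: "space (positive_part M \<nu>) = space M"
  unfolding positive_part_def by simp

section \<open>Test functions\<close>

lemma test_functionsD:
  assumes "\<phi> \<in> test_functions \<Omega>"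
  shows "C_k k \<phi>" "compact (supp \<phi>)" "supp \<phi> \<subseteq> \<Omega>"
  using assms unfolding test_functions_def by auto

lemma test_functions_mono: "V \<subseteq> \<Omega> \<Longrightarrow> test_functions V \<subseteq> test_functions \<Omega>"
  unfolding test_functions_def by auto

lemma outside_supp: "x \<notin> supp \<phi> \<Longrightarrow> \<phi> x = 0"
  unfolding supp_def using closure_subset[of "{x. \<phi> x \<noteq> 0}"] by blast

lemma test_function_differentiable: "\<phi> \<in> test_functions \<Omega> \<Longrightarrow> \<phi> differentiable (at x)"
  using test_functionsD(1)[of \<phi> \<Omega> "Suc 0"] by simp

lemma test_function_continuous: "\<phi> \<in> test_functions \<Omega> \<Longrightarrow> continuous_on A \<phi>"
  using test_functionsD(1)[of \<phi> \<Omega> 0] continuous_on_subset by auto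

lemma compact_supp_subset:
  assumes "compact (supp \<phi>)" "supp \<psi> \<subseteq> supp \<phi>"
  shows "compact (supp \<psi>)"
proof -
  have "compact (supp \<phi> \<inter> supp \<psi>)"
    using assms(1) by (rule compact_Int_closed) (simp add: supp_def)
  then show ?thesis using assms(2) by (simp add: Int_absorb1)
qed

lemma partial_outside_supp:
  assumes "x \<notin> supp \<phi>"
  shows "partial i \<phi> x = 0"
proof -
  have "(\<phi> has_derivative (\<lambda>_. 0)) (at x)"
  proof (rule has_derivative_transform_within_open)
    show "((\<lambda>_. 0) has_derivative (\<lambda>_. 0)) (at x)" by (rule has_derivative_const)
    show "open (- supp \<phi>)" by (simp add: supp_def open_Compl)
    show "x \<in> - supp \<phi>" using assms by simp
    show "0 = \<phi> y" if "y \<in> - supp \<phi>" for y using outside_supp[of y \<phi>] that by simp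
  qed
  then show ?thesis unfolding partial_def by (simp add: frechet_derivative_at[symmetric])
qed

lemma supp_partial_subset: "supp (partial i \<phi>) \<subseteq> supp \<phi>"
  unfolding supp_def[of "partial i \<phi>"]
proof (rule closure_minimal)
  show "{x. partial i \<phi> x \<noteq> 0} \<subseteq> supp \<phi>" using partial_outside_supp by blast
qed (simp add: supp_def)

lemma partial_test_function:
  assumes "\<phi> \<in> test_functions \<Omega>"
  shows "partial i \<phi> \<in> test_functions \<Omega>"
proof -
  have "C_k k (partial i \<phi>)" for k
    using test_functionsD(1)[OF assms, of "Suc k"] by simp
  moreover have "compact (supp (partial i \<phi>))"
    using test_functionsD(2)[OF assms] supp_partial_subset by (rule compact_supp_subset)
  ultimately show ?thesis
    using test_functionsD(3)[OF assms] supp_partial_subset[of i \<phi>] unfolding test_functions_def by blast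
qed

lemma funpow_partial_test_function:
  "\<phi> \<in> test_functions \<Omega> \<Longrightarrow> (partial i ^^ n) \<phi> \<in> test_functions \<Omega>"
  by (induction n) (auto intro: partial_test_function)

lemma multi_deriv_test_function:
  "\<phi> \<in> test_functions \<Omega> \<Longrightarrow> multi_deriv \<alpha> \<phi> \<in> test_functions \<Omega>"
  unfolding multi_deriv_def by (intro funpow_partial_test_function)

lemma test_function_bounded:
  assumes "\<phi> \<in> test_functions \<Omega>"
  shows "bdd_above (range (\<lambda>x. norm (\<phi> x)))"
proof -
  have "compact (\<phi> ` supp \<phi>)"
    using assms by (intro compact_continuous_image test_function_continuous test_functionsD)
  then have "bounded (\<phi> ` supp \<phi>)" by (rule compact_imp_bounded)
  then obtain C where C: "\<And>x. x \<in> supp \<phi> \<Longrightarrow> norm (\<phi> x) \<le> C"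
    unfolding bounded_iff by blast
  have "norm (\<phi> x) \<le> max 0 C" for x
    using C[of x] outside_supp[of x \<phi>] by (cases "x \<in> supp \<phi>") auto
  then show ?thesis by (rule bdd_aboveI2)
qed

lemma finite_multi_indices: "finite {\<alpha>::nat^3. (\<Sum>i\<in>UNIV. \<alpha>$i) \<le> k}" (is "finite ?S")
proof -
  have "?S \<subseteq> (\<lambda>(a, b, c). vector [a, b, c]) ` ({..k} \<times> {..k} \<times> {..k})"
  proof
    fix \<alpha> :: "nat^3" assume "\<alpha> \<in> ?S"
    then have "(\<alpha>$1, \<alpha>$2, \<alpha>$3) \<in> {..k} \<times> {..k} \<times> {..k}" by (simp add: sum_3)
    moreover have "\<alpha> = vector [\<alpha>$1, \<alpha>$2, \<alpha>$3]" by (simp add: vec_eq_iff forall_3)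
    ultimately show "\<alpha> \<in> (\<lambda>(a, b, c). vector [a, b, c]) ` ({..k} \<times> {..k} \<times> {..k})"
      by (metis (no_types, lifting) case_prod_conv image_eqI)
  qed
  then show ?thesis by (rule finite_subset) simp
qed

text \<open>A sum of suprema dominates each of its terms. This needs every supremum to be finite, so that
  it is nonnegative and an upper bound; that holds because all derivatives of a test
  function are test functions again, hence bounded.\<close>

lemma norm_multi_deriv_le_C_k_norm:
  assumes \<phi>: "\<phi> \<in> test_functions \<Omega>" and \<alpha>: "(\<Sum>i\<in>UNIV. \<alpha>$i) \<le> k"
  shows "norm (multi_deriv \<alpha> \<phi> x) \<le> C_k_norm k \<phi>"
proof -
  have bdd: "norm (multi_deriv \<beta> \<phi> y) \<le> (SUP x. norm (multi_deriv \<beta> \<phi> x))" for \<beta> y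
    by (intro cSUP_upper test_function_bounded[OF multi_deriv_test_function[OF \<phi>]]) simp
  have "(SUP x. norm (multi_deriv \<alpha> \<phi> x)) \<le> C_k_norm k \<phi>"
    unfolding C_k_norm_def using \<alpha> finite_multi_indices
    by (intro member_le_sum) (auto intro: order_trans[OF norm_ge_zero bdd])
  with bdd show ?thesis by (rule order_trans)
qed

lemma norm_le_C_k_norm:
  assumes "\<phi> \<in> test_functions \<Omega>"
  shows "norm (\<phi> x) \<le> C_k_norm k \<phi>"
  using norm_multi_deriv_le_C_k_norm[OF assms, of "\<chi> i. 0"] by (simp add: multi_deriv_def)

lemma norm_partial_le_C_k_norm:
  assumes "\<phi> \<in> test_functions \<Omega>"
  shows "norm (partial i \<phi> x) \<le> C_k_norm 1 \<phi>"
proof -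
  have "multi_deriv (axis i 1) \<phi> = partial i \<phi>"
    using exhaust_3[of i] by (auto simp: multi_deriv_def axis_def)
  then show ?thesis
    using norm_multi_deriv_le_C_k_norm[OF assms, of "axis i 1" 1 x] by (simp add: axis_def)
qed

lemma norm_grad_le_C_k_norm:
  assumes "\<phi> \<in> test_functions \<Omega>"
  shows "norm (grad \<phi> x) \<le> 3 * C_k_norm 1 \<phi>"
proof -
  have "norm (grad \<phi> x) \<le> (\<Sum>i\<in>UNIV. \<bar>partial i \<phi> x\<bar>)"
    using norm_le_l1_cart[of "grad \<phi> x"] by (simp add: grad_def)
  also have "\<dots> \<le> (\<Sum>i\<in>(UNIV::3 set). C_k_norm 1 \<phi>)"
    by (intro sum_mono) (use norm_partial_le_C_k_norm[OF assms] in simp)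
  finally show ?thesis by simp
qed

lemma grad_outside_supp: "x \<notin> supp \<phi> \<Longrightarrow> grad \<phi> x = 0"
  by (simp add: grad_def partial_outside_supp vec_eq_iff)

lemma continuous_on_grad:
  assumes "\<phi> \<in> test_functions \<Omega>"
  shows "continuous_on A (grad \<phi>)"
  unfolding grad_def
  by (intro continuous_on_vec_lambda test_function_continuous[OF partial_test_function[OF assms]])

lemma partial_add:
  assumes "\<phi> differentiable (at x)" "\<psi> differentiable (at x)"
  shows "partial i (\<lambda>x. \<phi> x + \<psi> x) x = partial i \<phi> x + partial i \<psi> x"
proof -
  have "((\<lambda>x. \<phi> x + \<psi> x) has_derivative
      (\<lambda>h. frechet_derivative \<phi> (at x) h + frechet_derivative \<psi> (at x) h)) (at x)"
    using assms by (intro has_derivative_add) (simp_all add: frechet_derivative_works[symmetric])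
  from frechet_derivative_at[OF this] show ?thesis unfolding partial_def by metis
qed

lemma partial_linear_image:
  assumes "bounded_linear L" "\<phi> differentiable (at x)"
  shows "partial i (\<lambda>x. L (\<phi> x)) x = L (partial i \<phi> x)"
proof -
  have "((\<lambda>x. L (\<phi> x)) has_derivative (\<lambda>h. L (frechet_derivative \<phi> (at x) h))) (at x)"
    using assms unfolding frechet_derivative_works by (rule bounded_linear.has_derivative)
  then show ?thesis by (simp add: partial_def frechet_derivative_at[symmetric])
qed

lemma grad_add:
  assumes "\<phi> \<in> test_functions \<Omega>" "\<psi> \<in> test_functions \<Omega>"
  shows "grad (\<lambda>x. \<phi> x + \<psi> x) x = grad \<phi> x + grad \<psi> x"
  using assms by (simp add: grad_def vec_eq_iff partial_add test_function_differentiable)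

lemma grad_scaleR:
  assumes "\<phi> \<in> test_functions \<Omega>"
  shows "grad (\<lambda>x. c *\<^sub>R \<phi> x) x = c *\<^sub>R grad \<phi> x"
  using partial_linear_image[OF bounded_linear_scaleR_right test_function_differentiable[OF assms]]
  by (simp add: grad_def vec_eq_iff)

section \<open>Integration against the curl measure\<close>

lemma set_integrable_bounded:
  fixes f :: "'a \<Rightarrow> real"
  assumes "finite_measure N" "A \<in> sets N" "f \<in> borel_measurable N"
    and B: "\<And>x. \<bar>f x\<bar> \<le> B"
  shows "set_integrable N A f"
proof -
  have "0 \<le> B" by (rule order_trans[OF abs_ge_zero B])
  then have "norm (indicat_real A x *\<^sub>R f x) \<le> B" for x
    using B[of x] by (simp add: indicator_def)
  then show ?thesis
    unfolding set_integrable_def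
    by (intro finite_measure.integrable_const_bound[OF assms(1), of _ B]) (use assms in auto)
qed

lemma norm_LINT_le:
  fixes f :: "'a \<Rightarrow> real"
  assumes "finite_measure N" "A \<in> sets N" "f \<in> borel_measurable N"
    and B: "\<And>x. \<bar>f x\<bar> \<le> B"
  shows "\<bar>LINT x:A|N. f x\<bar> \<le> measure N (space N) * B"
proof -
  have "0 \<le> B" by (rule order_trans[OF abs_ge_zero B])
  then have le: "norm (indicat_real A x *\<^sub>R f x) \<le> B" for x
    using B[of x] by (simp add: indicator_def)
  have const: "integrable N (\<lambda>x. B)" by (rule finite_measure.integrable_const) fact
  have "norm (LINT x:A|N. f x) \<le> (LINT x|N. norm (indicat_real A x *\<^sub>R f x))"
    unfolding set_lebesgue_integral_def by (rule integral_norm_bound)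
  also have "\<dots> \<le> (LINT x|N. B)"
    using const set_integrable_bounded[OF assms] le
    by (intro integral_mono integrable_norm) (simp_all add: set_integrable_def)
  finally show ?thesis by simp
qed

lemma signed_measure_component:
  assumes "finite_radon_measure \<Omega> \<mu>"
  shows "signed_measure (restrict_space borel \<Omega>) (\<lambda>B. \<mu> B $ i)"
  using assms bounded_linear.sums[OF bounded_linear_vec_nth]
  unfolding finite_radon_measure_def signed_measure_def by blast

lemma test_function_measurable:
  fixes \<phi> :: "real^3 \<Rightarrow> real"
  assumes "\<phi> \<in> test_functions \<Omega>'"
  shows "\<phi> \<in> borel_measurable (restrict_space borel \<Omega>)"
  by (intro measurable_restrict_space1 borel_measurable_continuous_onI test_function_continuous[OF assms])

context
  fixes \<Omega> S :: "(real^3) set" and \<mu>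
  assumes \<mu>: "finite_radon_measure \<Omega> \<mu>" and S: "S \<in> sets (restrict_space borel \<Omega>)"
begin

lemma finite_parts:
  "finite_measure (positive_part (restrict_space borel \<Omega>) (\<lambda>B. \<mu> B $ i))"
  "finite_measure (positive_part (restrict_space borel \<Omega>) (\<lambda>B. - (\<mu> B $ i)))"
  using signed_measure.finite_measure_positive_part signed_measure.uminus
    signed_measure_component[OF \<mu>, of i] by blast+

lemma test_function_integrable_parts:
  fixes \<phi> :: "real^3 \<Rightarrow> real"
  assumes "\<phi> \<in> test_functions \<Omega>"
  shows "set_integrable (positive_part (restrict_space borel \<Omega>) (\<lambda>B. \<mu> B $ i)) S \<phi>"
    and "set_integrable (positive_part (restrict_space borel \<Omega>) (\<lambda>B. - (\<mu> B $ i))) S \<phi>"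
proof -
  have "set_integrable (positive_part (restrict_space borel \<Omega>) \<nu>) S \<phi>"
    if "finite_measure (positive_part (restrict_space borel \<Omega>) \<nu>)" for \<nu>
    using that
  proof (rule set_integrable_bounded)
    show "\<bar>\<phi> x\<bar> \<le> C_k_norm 0 \<phi>" for x using norm_le_C_k_norm[OF assms, of x 0] by simp
    show "\<phi> \<in> borel_measurable (positive_part (restrict_space borel \<Omega>) \<nu>)"
      unfolding measurable_cong_sets[OF sets_positive_part refl] by (rule test_function_measurable[OF assms])
  qed (use S in simp)
  from this[OF finite_parts(1)] this[OF finite_parts(2)]
  show "set_integrable (positive_part (restrict_space borel \<Omega>) (\<lambda>B. \<mu> B $ i)) S \<phi>"
    and "set_integrable (positive_part (restrict_space borel \<Omega>) (\<lambda>B. - (\<mu> B $ i))) S \<phi>" .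
qed

lemma radon_integral_add:
  assumes "\<phi> \<in> test_functions \<Omega>" "\<psi> \<in> test_functions \<Omega>"
  shows "radon_integral \<Omega> \<mu> S (\<lambda>x. \<phi> x + \<psi> x) = radon_integral \<Omega> \<mu> S \<phi> + radon_integral \<Omega> \<mu> S \<psi>"
  using assms
  by (simp add: radon_integral_def signed_integral_def vec_eq_iff set_integral_add test_function_integrable_parts)

lemma radon_integral_scaleR:
  "radon_integral \<Omega> \<mu> S (\<lambda>x. c *\<^sub>R \<phi> x) = c *\<^sub>R radon_integral \<Omega> \<mu> S \<phi>"
  by (simp add: radon_integral_def signed_integral_def vec_eq_iff right_diff_distrib)

lemma radon_integral_bound:
  obtains C where "\<And>\<phi> k. \<phi> \<in> test_functions \<Omega> \<Longrightarrow> norm (radon_integral \<Omega> \<mu> S \<phi>) \<le> C * C_k_norm k \<phi>"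
proof -
  define m where "m \<nu> = measure (positive_part (restrict_space borel \<Omega>) \<nu>) (space (restrict_space borel \<Omega>))"
    for \<nu>
  have "norm (radon_integral \<Omega> \<mu> S \<phi>)
      \<le> (\<Sum>i\<in>UNIV. m (\<lambda>B. \<mu> B $ i) + m (\<lambda>B. - (\<mu> B $ i))) * C_k_norm k \<phi>"
    if \<phi>: "\<phi> \<in> test_functions \<Omega>" for \<phi> k
  proof -
    have "\<bar>LINT x:S|positive_part (restrict_space borel \<Omega>) \<nu>. \<phi> x\<bar> \<le> m \<nu> * C_k_norm k \<phi>"
      if "finite_measure (positive_part (restrict_space borel \<Omega>) \<nu>)" for \<nu>
      unfolding m_def space_positive_part[of "restrict_space borel \<Omega>" \<nu>, symmetric]
      using that
    proof (rule norm_LINT_le)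
      show "\<bar>\<phi> x\<bar> \<le> C_k_norm k \<phi>" for x using norm_le_C_k_norm[OF \<phi>, of x k] by simp
      show "\<phi> \<in> borel_measurable (positive_part (restrict_space borel \<Omega>) \<nu>)"
        unfolding measurable_cong_sets[OF sets_positive_part refl] by (rule test_function_measurable[OF \<phi>])
    qed (use S in simp)
    note parts = this[OF finite_parts(1)] this[OF finite_parts(2)]
    have "\<bar>radon_integral \<Omega> \<mu> S \<phi> $ i\<bar> \<le> (m (\<lambda>B. \<mu> B $ i) + m (\<lambda>B. - (\<mu> B $ i))) * C_k_norm k \<phi>" for i
      unfolding radon_integral_def signed_integral_def distrib_right vec_lambda_beta
      by (intro order_trans[OF abs_triangle_ineq4] add_mono parts)
    then show ?thesis
      by (intro order_trans[OF norm_le_l1_cart]) (simp add: sum_distrib_right sum_mono)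
  qed
  then show ?thesis by (rule that)
qed

end

section \<open>Integrals of the field against gradients\<close>

lemma norm_cross3_le: "norm (cross3 x y) \<le> norm x * norm y"
proof (rule power2_le_imp_le)
  show "(norm (cross3 x y))\<^sup>2 \<le> (norm x * norm y)\<^sup>2"
    using norm_cross_dot[of x y] zero_le_power2[of "x \<bullet> y"] by linarith
qed simp

lemma Lp_measurable:
  assumes "F \<in> Lp p \<Omega>" "open \<Omega>"
  shows "(\<lambda>x. indicator \<Omega> x *\<^sub>R F x) \<in> borel_measurable lebesgue"
  using assms borel_measurable_restrict_space_iff[of \<Omega> lebesgue F] by (simp add: Lp_def)

lemma le_one_plus_powr:
  fixes t q :: real
  assumes "0 \<le> t" "1 \<le> q"
  shows "t \<le> 1 + t powr q"
proof (cases "t \<le> 1")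
  case False
  then have "t powr 1 \<le> t powr q" using assms by (intro powr_mono) auto
  with False show ?thesis by simp
qed (simp add: add_increasing2)

text \<open>On \<open>K\<close> dominate \<open>\<bar>F\<bar>\<close> by its essential bound if \<open>p = \<infinity>\<close>, and by \<open>1 + \<bar>F\<bar>\<^sup>p\<close> otherwise; the
  latter avoids Hoelder's inequality.\<close>

lemma Lp_locally_integrable:
  assumes F: "F \<in> Lp p \<Omega>" and "1 \<le> p" "open \<Omega>" and K: "compact K" "K \<subseteq> \<Omega>"
  shows "set_integrable lebesgue K F"
proof -
  have F_meas: "F \<in> borel_measurable (lebesgue_on \<Omega>)" using F by (simp add: Lp_def)
  have \<Omega>: "\<Omega> \<in> sets lebesgue" using \<open>open \<Omega>\<close> by simp
  have K_meas: "K \<in> sets (lebesgue_on \<Omega>)"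
    using K \<Omega> lmeasurable_compact[of K] by (auto simp: sets_restrict_space_iff fmeasurableD)
  have "integrable lebesgue (indicat_real K)"
    using lmeasurable_compact[OF K(1)] by (simp add: lmeasurable_iff_integrable)
  moreover have "(\<lambda>x. indicat_real \<Omega> x *\<^sub>R indicat_real K x) = indicat_real K"
    using K by (auto simp: fun_eq_iff indicator_def)
  ultimately have intK: "integrable (lebesgue_on \<Omega>) (indicat_real K)"
    using \<Omega> by (simp add: integrable_restrict_space)
  have "integrable (lebesgue_on \<Omega>) (\<lambda>x. indicat_real K x *\<^sub>R F x)"
  proof (cases "p = \<infinity>")
    case True
    then obtain C where C: "AE x in lebesgue_on \<Omega>. norm (F x) \<le> C" using F by (auto simp: Lp_def)
    show ?thesis
    proof (rule Bochner_Integration.integrable_bound)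
      show "integrable (lebesgue_on \<Omega>) (\<lambda>x. C * indicat_real K x)" using intK by simp
      show "AE x in lebesgue_on \<Omega>. norm (indicat_real K x *\<^sub>R F x) \<le> norm (C * indicat_real K x)"
        using C by eventually_elim (auto simp: indicator_def)
    qed (use F_meas K_meas in simp)
  next
    case False
    then have q: "1 \<le> enn2real p"
      using \<open>1 \<le> p\<close> by (metis enn2real_1 enn2real_mono infinity_ennreal_def less_top)
    show ?thesis
    proof (rule Bochner_Integration.integrable_bound)
      show "integrable (lebesgue_on \<Omega>) (\<lambda>x. indicat_real K x + norm (F x) powr enn2real p)"
        using intK F False by (simp add: Lp_def)
      show "AE x in lebesgue_on \<Omega>. norm (indicat_real K x *\<^sub>R F x)
          \<le> norm (indicat_real K x + norm (F x) powr enn2real p)"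
        using le_one_plus_powr[OF norm_ge_zero q] by (auto simp: indicator_def)
    qed (use F_meas K_meas in simp)
  qed
  then have "integrable lebesgue (\<lambda>x. indicat_real \<Omega> x *\<^sub>R indicat_real K x *\<^sub>R F x)"
    using \<Omega> by (simp add: integrable_restrict_space)
  moreover have "(\<lambda>x. indicat_real \<Omega> x *\<^sub>R indicat_real K x *\<^sub>R F x) = (\<lambda>x. indicat_real K x *\<^sub>R F x)"
    using K by (auto simp: fun_eq_iff indicator_def)
  ultimately show ?thesis by (simp add: set_integrable_def)
qed

text \<open>The indicator of \<open>S\<close> may be exchanged for that of \<open>K\<close> because the gradient vanishes off the
  support. The right-hand side is integrable by local integrability of \<open>F\<close>, which may fail
  with \<open>S\<close> in place of \<open>K\<close>.\<close>

lemma norm_cross_grad_le: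
  assumes \<phi>: "\<phi> \<in> test_functions \<Omega>" and "supp \<phi> \<subseteq> K"
  shows "norm (indicat_real S x *\<^sub>R cross3 (F x) (grad \<phi> x))
    \<le> (3 * C_k_norm 1 \<phi>) * norm (indicat_real K x *\<^sub>R F x)"
proof (cases "x \<in> K")
  case True
  have "norm (cross3 (F x) (grad \<phi> x)) \<le> norm (F x) * (3 * C_k_norm 1 \<phi>)"
    by (intro order_trans[OF norm_cross3_le] mult_left_mono norm_grad_le_C_k_norm[OF \<phi>]) simp
  moreover have "0 \<le> norm (F x) * (3 * C_k_norm 1 \<phi>)"
    by (intro order_trans[OF norm_ge_zero calculation])
  ultimately show ?thesis using True by (simp add: indicator_def mult.commute)
next
  case False
  then have "grad \<phi> x = 0" using assms(2) grad_outside_supp by blast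
  then show ?thesis using False by simp
qed

lemma cross_grad_integrable:
  assumes F: "F \<in> Lp p \<Omega>" "1 \<le> p" "open \<Omega>" and S: "open S" "S \<subseteq> \<Omega>" and \<phi>: "\<phi> \<in> test_functions \<Omega>"
  shows "set_integrable lebesgue S (\<lambda>x. cross3 (F x) (grad \<phi> x))"
  unfolding set_integrable_def
proof (rule Bochner_Integration.integrable_bound)
  show "integrable lebesgue (\<lambda>x. (3 * C_k_norm 1 \<phi>) * norm (indicat_real (supp \<phi>) x *\<^sub>R F x))"
    using Lp_locally_integrable[OF F test_functionsD(2,3)[OF \<phi>]]
    by (intro integrable_mult_right integrable_norm) (simp add: set_integrable_def)
  have grad_meas: "grad \<phi> \<in> borel_measurable lebesgue"
    by (intro measurable_completion) (simp add: borel_measurable_continuous_onI continuous_on_grad[OF \<phi>])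
  have cross_continuous: "continuous_on UNIV (\<lambda>z::(real^3) \<times> (real^3). cross3 (fst z) (snd z))"
    by (intro continuous_on_cross continuous_on_fst continuous_on_snd continuous_on_id)
  \<comment> \<open>\<open>F\<close> is measurable on \<open>\<Omega>\<close> only, so it is first cut off outside \<open>\<Omega>\<close>.\<close>
  have "(\<lambda>x. cross3 (indicat_real \<Omega> x *\<^sub>R F x) (grad \<phi> x)) \<in> borel_measurable lebesgue"
    by (rule borel_measurable_continuous_Pair[OF Lp_measurable[OF F(1,3)] grad_meas cross_continuous])
  then have "(\<lambda>x. indicat_real S x *\<^sub>R cross3 (indicat_real \<Omega> x *\<^sub>R F x) (grad \<phi> x)) \<in> borel_measurable lebesgue"
    using S by (intro borel_measurable_scaleR borel_measurable_indicator) auto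
  moreover have "(\<lambda>x. indicat_real S x *\<^sub>R cross3 (indicat_real \<Omega> x *\<^sub>R F x) (grad \<phi> x))
      = (\<lambda>x. indicat_real S x *\<^sub>R cross3 (F x) (grad \<phi> x))"
    using S by (auto simp: fun_eq_iff indicator_def)
  ultimately show "(\<lambda>x. indicat_real S x *\<^sub>R cross3 (F x) (grad \<phi> x)) \<in> borel_measurable lebesgue"
    by simp
  show "AE x in lebesgue. norm (indicat_real S x *\<^sub>R cross3 (F x) (grad \<phi> x))
      \<le> norm ((3 * C_k_norm 1 \<phi>) * norm (indicat_real (supp \<phi>) x *\<^sub>R F x))"
    unfolding real_norm_def
    by (intro AE_I2 order_trans[OF norm_cross_grad_le[OF \<phi> order_refl]] abs_ge_self)
qed

lemma norm_LINT_cross_grad_le: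
  assumes F: "F \<in> Lp p \<Omega>" "1 \<le> p" "open \<Omega>" and S: "open S" "S \<subseteq> \<Omega>" and \<phi>: "\<phi> \<in> test_functions \<Omega>"
    and K: "compact K" "K \<subseteq> \<Omega>" "supp \<phi> \<subseteq> K"
  shows "norm (LINT x:S|lebesgue. cross3 (F x) (grad \<phi> x))
    \<le> 3 * (LINT x:K|lebesgue. norm (F x)) * C_k_norm 1 \<phi>"
proof -
  have "integrable lebesgue (\<lambda>x. norm (indicat_real K x *\<^sub>R F x))"
    using Lp_locally_integrable[OF F K(1,2)] by (intro integrable_norm) (simp add: set_integrable_def)
  then have "norm (LINT x:S|lebesgue. cross3 (F x) (grad \<phi> x))
      \<le> (LINT x|lebesgue. (3 * C_k_norm 1 \<phi>) * norm (indicat_real K x *\<^sub>R F x))"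
    unfolding set_lebesgue_integral_def
    using cross_grad_integrable[OF F S \<phi>] norm_cross_grad_le[OF \<phi> K(3)]
    by (intro Bochner_Integration.integral_norm_bound_integral integrable_mult_right)
       (simp_all only: set_integrable_def)
  also have "\<dots> = (3 * C_k_norm 1 \<phi>) * (LINT x|lebesgue. norm (indicat_real K x *\<^sub>R F x))"
    by (rule integral_mult_right_zero)
  also have "\<dots> = 3 * (LINT x:K|lebesgue. norm (F x)) * C_k_norm 1 \<phi>"
    by (simp add: set_lebesgue_integral_def)
  finally show ?thesis .
qed

section \<open>Operations on distributions\<close>

lemma distribution_if_order_at_most:
  "linear_on_tests \<Omega> T \<Longrightarrow> order_at_most \<Omega> T N \<Longrightarrow> distribution \<Omega> T"
  unfolding distribution_def order_at_most_def by blast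

lemma dist_support_subset:
  assumes "open V" "V \<subseteq> \<Omega>" "open W" "W \<subseteq> \<Omega>"
    and "\<And>\<phi>. \<phi> \<in> test_functions V \<Longrightarrow> T \<phi> = 0" "\<And>\<phi>. \<phi> \<in> test_functions W \<Longrightarrow> T \<phi> = 0"
  shows "dist_support \<Omega> T \<subseteq> \<Omega> - (V \<union> W)"
  using assms unfolding dist_support_def by blast

lemma linear_on_tests_uminus:
  "linear_on_tests \<Omega> T \<Longrightarrow> linear_on_tests \<Omega> (\<lambda>\<phi>. - T \<phi>)"
  unfolding linear_on_tests_def by auto

text \<open>The passage from a vector-valued functional on scalar test functions to a scalar functional
  on vector fields, by which both traces on vector fields are defined. It preserves linearity,
  the order and bounds on the support.\<close>

definition componentwise :: "((real^3 \<Rightarrow> real) \<Rightarrow> real^3) \<Rightarrow> (real^3 \<Rightarrow> real^3) \<Rightarrow> real" where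
  "componentwise T \<phi> = (\<Sum>i\<in>UNIV. T (\<lambda>x. \<phi> x $ i) $ i)"

lemma
  fixes \<phi> :: "real^3 \<Rightarrow> real^3"
  assumes "\<phi> \<in> test_functions \<Omega>"
  shows partial_component: "partial j (\<lambda>x. \<phi> x $ i) = (\<lambda>x. partial j \<phi> x $ i)"
    and multi_deriv_component: "multi_deriv \<alpha> (\<lambda>x. \<phi> x $ i) = (\<lambda>x. multi_deriv \<alpha> \<phi> x $ i)"
proof -
  have partial: "partial j (\<lambda>x. \<psi> x $ i) = (\<lambda>x. partial j \<psi> x $ i)"
    if "\<psi> \<in> test_functions \<Omega>" for j and \<psi> :: "real^3 \<Rightarrow> real^3"
    using partial_linear_image[OF bounded_linear_vec_nth test_function_differentiable[OF that]] by blast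
  then show "partial j (\<lambda>x. \<phi> x $ i) = (\<lambda>x. partial j \<phi> x $ i)" using assms .
  have "(partial j ^^ n) (\<lambda>x. \<psi> x $ i) = (\<lambda>x. (partial j ^^ n) \<psi> x $ i)"
    if "\<psi> \<in> test_functions \<Omega>" for j n and \<psi> :: "real^3 \<Rightarrow> real^3"
    by (induction n) (simp_all add: partial funpow_partial_test_function[OF that])
  then show "multi_deriv \<alpha> (\<lambda>x. \<phi> x $ i) = (\<lambda>x. multi_deriv \<alpha> \<phi> x $ i)"
    using assms by (simp add: multi_deriv_def funpow_partial_test_function)
qed

lemma supp_component_subset: "supp (\<lambda>x. \<phi> x $ i) \<subseteq> supp \<phi>"
  unfolding supp_def by (intro closure_mono) auto

lemma component_test_function:
  fixes \<phi> :: "real^3 \<Rightarrow> real^3"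
  assumes "\<phi> \<in> test_functions \<Omega>"
  shows "(\<lambda>x. \<phi> x $ i) \<in> test_functions \<Omega>"
proof -
  have "C_k k (\<lambda>x. \<psi> x $ i)" if "\<psi> \<in> test_functions \<Omega>" for k and \<psi> :: "real^3 \<Rightarrow> real^3"
    using that
  proof (induction k arbitrary: \<psi>)
    case 0
    then show ?case by (simp add: continuous_on_component test_function_continuous[of \<psi> \<Omega>])
  next
    case (Suc k)
    have "(\<lambda>x. \<psi> x $ i) differentiable (at x)" for x
      using bounded_linear.has_derivative[OF bounded_linear_vec_nth
          test_function_differentiable[OF Suc.prems, of x, unfolded frechet_derivative_works]]
      by (rule differentiableI)
    with Suc.IH[OF partial_test_function[OF Suc.prems]] show ?case
      by (simp add: partial_component[OF Suc.prems])
  qed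
  note C_k = this[OF assms]
  have "compact (supp (\<lambda>x. \<phi> x $ i))"
    using test_functionsD(2)[OF assms] supp_component_subset by (rule compact_supp_subset)
  with C_k show ?thesis
    using test_functionsD(3)[OF assms] supp_component_subset[of \<phi> i] unfolding test_functions_def by blast
qed

lemma C_k_norm_component_le:
  fixes \<phi> :: "real^3 \<Rightarrow> real^3"
  assumes \<phi>: "\<phi> \<in> test_functions \<Omega>"
  shows "C_k_norm k (\<lambda>x. \<phi> x $ i) \<le> C_k_norm k \<phi>"
  unfolding C_k_norm_def
proof (rule sum_mono)
  fix \<alpha> :: "nat^3"
  show "(SUP x. norm (multi_deriv \<alpha> (\<lambda>x. \<phi> x $ i) x)) \<le> (SUP x. norm (multi_deriv \<alpha> \<phi> x))"
    unfolding multi_deriv_component[OF \<phi>]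
    by (intro cSUP_mono test_function_bounded[OF multi_deriv_test_function[OF \<phi>]])
       (auto intro: component_le_norm_cart)
qed

lemma linear_on_tests_componentwise:
  assumes "linear_on_tests \<Omega> T"
  shows "linear_on_tests \<Omega> (componentwise T)"
  using assms
  by (simp add: linear_on_tests_def componentwise_def component_test_function sum.distrib sum_distrib_left)

lemma order_at_most_componentwise:
  assumes T: "order_at_most \<Omega> T N"
  shows "order_at_most \<Omega> (componentwise T) N"
  unfolding order_at_most_def
proof (intro allI impI)
  fix K assume K: "compact K \<and> K \<subseteq> \<Omega>"
  from T[unfolded order_at_most_def, rule_format, OF K]
  obtain C where C: "\<forall>\<phi>\<in>test_functions \<Omega>. supp \<phi> \<subseteq> K \<longrightarrow> norm (T \<phi>) \<le> C * C_k_norm N \<phi>" ..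
  have "norm (componentwise T \<phi>) \<le> (3 * \<bar>C\<bar>) * C_k_norm N \<phi>"
    if \<phi>: "\<phi> \<in> test_functions \<Omega>" "supp \<phi> \<subseteq> K" for \<phi>
  proof -
    have "\<bar>T (\<lambda>x. \<phi> x $ i) $ i\<bar> \<le> \<bar>C\<bar> * C_k_norm N \<phi>" for i
    proof -
      have nonneg: "0 \<le> C_k_norm N (\<lambda>x. \<phi> x $ i)"
        using order_trans[OF norm_ge_zero norm_le_C_k_norm[OF component_test_function[OF \<phi>(1)]]] .
      have "\<bar>T (\<lambda>x. \<phi> x $ i) $ i\<bar> \<le> norm (T (\<lambda>x. \<phi> x $ i))" by (rule component_le_norm_cart)
      also have "\<dots> \<le> C * C_k_norm N (\<lambda>x. \<phi> x $ i)"
        using C component_test_function[OF \<phi>(1)] subset_trans[OF supp_component_subset \<phi>(2)] by simp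
      also have "\<dots> \<le> \<bar>C\<bar> * C_k_norm N (\<lambda>x. \<phi> x $ i)"
        using nonneg by (intro mult_right_mono) auto
      also have "\<dots> \<le> \<bar>C\<bar> * C_k_norm N \<phi>"
        by (intro mult_left_mono C_k_norm_component_le[OF \<phi>(1)]) simp
      finally show ?thesis .
    qed
    then have "(\<Sum>i\<in>UNIV. \<bar>T (\<lambda>x. \<phi> x $ i) $ i\<bar>) \<le> (\<Sum>i\<in>(UNIV::3 set). \<bar>C\<bar> * C_k_norm N \<phi>)"
      by (intro sum_mono)
    then show ?thesis
      unfolding componentwise_def real_norm_def by (intro order_trans[OF sum_abs]) simp
  qed
  then show "\<exists>C. \<forall>\<phi>\<in>test_functions \<Omega>. supp \<phi> \<subseteq> K \<longrightarrow> norm (componentwise T \<phi>) \<le> C * C_k_norm N \<phi>"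
    by blast
qed

text \<open>If \<open>T\<close> vanishes on the test functions of an open set, it does so on the components of every
  vector field supported there.\<close>

lemma dist_support_componentwise: "dist_support \<Omega> (componentwise T) \<subseteq> dist_support \<Omega> T"
  unfolding dist_support_def componentwise_def by (auto simp: component_test_function)

section \<open>Tangential traces\<close>

text \<open>The formula of the interior trace with the curl measure as a parameter and for arbitrary
  sets \<open>S\<close>, so that it covers \<open>U\<close>, \<open>\<Omega> - closure U\<close>, \<open>\<Omega>\<close> and \<open>{}\<close> at once.\<close>

definition interior_trace ::
    "(real^3) set \<Rightarrow> (real^3 \<Rightarrow> real^3) \<Rightarrow> ((real^3) set \<Rightarrow> real^3) \<Rightarrow> (real^3) set \<Rightarrow> (real^3 \<Rightarrow> real) \<Rightarrow> real^3" where
  "interior_trace \<Omega> F \<mu> S \<phi> = radon_integral \<Omega> \<mu> S \<phi> - (LINT x:S|lebesgue. cross3 (F x) (grad \<phi> x))"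

lemma radon_integral_cong_set:
  assumes "\<And>x. indicat_real A x *\<^sub>R \<phi> x = indicat_real B x *\<^sub>R \<phi> x"
  shows "radon_integral \<Omega> \<mu> A \<phi> = radon_integral \<Omega> \<mu> B \<phi>"
  unfolding radon_integral_def signed_integral_def set_lebesgue_integral_def assms ..

lemma interior_trace_cong_set:
  assumes "supp \<phi> \<inter> A = supp \<phi> \<inter> B"
  shows "interior_trace \<Omega> F \<mu> A \<phi> = interior_trace \<Omega> F \<mu> B \<phi>"
proof -
  have *: "indicat_real A x = indicat_real B x" if "x \<in> supp \<phi>" for x
    using assms that by (auto simp: indicator_def)
  have "indicat_real A x *\<^sub>R \<phi> x = indicat_real B x *\<^sub>R \<phi> x" for x
    using *[of x] outside_supp[of x \<phi>] by (cases "x \<in> supp \<phi>") simp_all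
  then have "radon_integral \<Omega> \<mu> A \<phi> = radon_integral \<Omega> \<mu> B \<phi>"
    by (rule radon_integral_cong_set)
  moreover have "indicat_real A x *\<^sub>R cross3 (F x) (grad \<phi> x)
      = indicat_real B x *\<^sub>R cross3 (F x) (grad \<phi> x)" for x
    using *[of x] grad_outside_supp[of x \<phi>] by (cases "x \<in> supp \<phi>") simp_all
  ultimately show ?thesis
    unfolding interior_trace_def set_lebesgue_integral_def by (simp only:)
qed

lemma interior_trace_outside:
  assumes "supp \<phi> \<inter> S = {}"
  shows "interior_trace \<Omega> F \<mu> S \<phi> = 0"
  using interior_trace_cong_set[of \<phi> S "{}" \<Omega> F \<mu>] assms
  by (simp add: interior_trace_def radon_integral_def signed_integral_def set_lebesgue_integral_def vec_eq_iff)

text \<open>For \<open>S = \<Omega>\<close> the vanishing of the trace is the identity that defines the distributional curl,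
  and a test function supported in \<open>S\<close> does not distinguish \<open>S\<close> from \<open>\<Omega>\<close>.\<close>

lemma interior_trace_inside:
  assumes "is_curl_measure \<Omega> F \<mu>" "S \<subseteq> \<Omega>" "\<phi> \<in> test_functions S"
  shows "interior_trace \<Omega> F \<mu> S \<phi> = 0"
proof -
  have "interior_trace \<Omega> F \<mu> S \<phi> = interior_trace \<Omega> F \<mu> \<Omega> \<phi>"
    using assms test_functionsD(3)[OF assms(3)] by (intro interior_trace_cong_set) auto
  also have "\<dots> = 0"
    using assms test_functions_mono[of S \<Omega>]
    by (auto simp: interior_trace_def is_curl_measure_def distributional_curl_def)
  finally show ?thesis .
qed

context
  fixes \<Omega> S :: "(real^3) set" and F :: "real^3 \<Rightarrow> real^3" and p :: ennreal and \<mu>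
  assumes \<Omega>: "open \<Omega>" and p: "1 \<le> p" and F: "F \<in> Lp p \<Omega>" and \<mu>: "finite_radon_measure \<Omega> \<mu>"
    and S: "open S" "S \<subseteq> \<Omega>"
begin

lemma S_measurable: "S \<in> sets (restrict_space borel \<Omega>)"
  using S \<Omega> by (simp add: sets_restrict_space_iff)

lemma linear_on_tests_interior_trace: "linear_on_tests \<Omega> (interior_trace \<Omega> F \<mu> S)"
  unfolding linear_on_tests_def
proof (intro conjI ballI allI)
  fix \<phi> \<psi> :: "real^3 \<Rightarrow> real" and c :: real
  assume \<phi>: "\<phi> \<in> test_functions \<Omega>"
  show "interior_trace \<Omega> F \<mu> S (\<lambda>x. c *\<^sub>R \<phi> x) = c *\<^sub>R interior_trace \<Omega> F \<mu> S \<phi>"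
    unfolding interior_trace_def grad_scaleR[OF \<phi>] cross_mult_right radon_integral_scaleR[OF \<mu> S_measurable]
    by (simp add: scaleR_diff_right)
  assume \<psi>: "\<psi> \<in> test_functions \<Omega>"
  show "interior_trace \<Omega> F \<mu> S (\<lambda>x. \<phi> x + \<psi> x) = interior_trace \<Omega> F \<mu> S \<phi> + interior_trace \<Omega> F \<mu> S \<psi>"
    unfolding interior_trace_def grad_add[OF \<phi> \<psi>] cross_add_right radon_integral_add[OF \<mu> S_measurable \<phi> \<psi>]
    using cross_grad_integrable[OF F p \<Omega> S \<phi>] cross_grad_integrable[OF F p \<Omega> S \<psi>]
    by (simp add: set_integral_add)
qed

lemma order_at_most_interior_trace: "order_at_most \<Omega> (interior_trace \<Omega> F \<mu> S) 1"
  unfolding order_at_most_def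
proof (intro allI impI)
  fix K assume K: "compact K \<and> K \<subseteq> \<Omega>"
  obtain C where C: "\<And>\<phi> k. \<phi> \<in> test_functions \<Omega> \<Longrightarrow> norm (radon_integral \<Omega> \<mu> S \<phi>) \<le> C * C_k_norm k \<phi>"
    using radon_integral_bound[OF \<mu> S_measurable] by blast
  have "norm (interior_trace \<Omega> F \<mu> S \<phi>) \<le> (C + 3 * (LINT x:K|lebesgue. norm (F x))) * C_k_norm 1 \<phi>"
    if \<phi>: "\<phi> \<in> test_functions \<Omega>" "supp \<phi> \<subseteq> K" for \<phi>
    unfolding interior_trace_def distrib_right
    using K \<phi> by (intro norm_triangle_le_diff add_mono C norm_LINT_cross_grad_le[OF F p \<Omega> S]) auto
  then show "\<exists>C. \<forall>\<phi>\<in>test_functions \<Omega>. supp \<phi> \<subseteq> K \<longrightarrow>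
      norm (interior_trace \<Omega> F \<mu> S \<phi>) \<le> C * C_k_norm 1 \<phi>"
    by blast
qed

end

theorem theorem3p2:
  fixes \<Omega> U :: "(real^3) set" and F :: "real^3 \<Rightarrow> real^3" and p :: ennreal
  assumes "open \<Omega>" and "1 \<le> p" and "F \<in> CM p \<Omega>"
    and "open U" and "bounded U" and "closure U \<subseteq> \<Omega>"
  shows "(distribution \<Omega> (trace_int \<Omega> F U)
       \<and> dist_support \<Omega> (trace_int \<Omega> F U) \<subseteq> frontier U
       \<and> order_at_most \<Omega> (trace_int \<Omega> F U) 1)
     \<and> (distribution \<Omega> (trace_int_vec \<Omega> F U)
       \<and> dist_support \<Omega> (trace_int_vec \<Omega> F U) \<subseteq> frontier U
       \<and> order_at_most \<Omega> (trace_int_vec \<Omega> F U) 1)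
     \<and> (distribution \<Omega> (trace_ext \<Omega> F U)
       \<and> dist_support \<Omega> (trace_ext \<Omega> F U) \<subseteq> frontier U
       \<and> order_at_most \<Omega> (trace_ext \<Omega> F U) 1)
     \<and> (distribution \<Omega> (trace_ext_vec \<Omega> F U)
       \<and> dist_support \<Omega> (trace_ext_vec \<Omega> F U) \<subseteq> frontier U
       \<and> order_at_most \<Omega> (trace_ext_vec \<Omega> F U) 1)"
proof -
  define \<mu> where "\<mu> = curl_measure \<Omega> F"
  define W where "W = \<Omega> - closure U"
  have F: "F \<in> Lp p \<Omega>" using \<open>F \<in> CM p \<Omega>\<close> by (simp add: CM_def)
  have curl: "is_curl_measure \<Omega> F \<mu>"
    using \<open>F \<in> CM p \<Omega>\<close> someI_ex[of "is_curl_measure \<Omega> F"] by (simp add: CM_def \<mu>_def curl_measure_def)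
  then have \<mu>: "finite_radon_measure \<Omega> \<mu>" by (simp add: is_curl_measure_def)
  have U: "open U" "U \<subseteq> \<Omega>" using assms closure_subset by blast+
  have W: "open W" "W \<subseteq> \<Omega>" unfolding W_def using \<open>open \<Omega>\<close> by auto
  have UW: "U \<inter> W = {}" unfolding W_def using closure_subset by blast
  have frontier: "\<Omega> - (U \<union> W) = frontier U"
    using assms closure_subset[of U] by (auto simp: W_def frontier_def interior_open)
  have int_eq: "trace_int \<Omega> F U = interior_trace \<Omega> F \<mu> U"
    by (simp add: fun_eq_iff trace_int_def interior_trace_def \<mu>_def)
  have ext_eq: "trace_ext \<Omega> F U = (\<lambda>\<phi>. - interior_trace \<Omega> F \<mu> W \<phi>)"
    by (simp add: fun_eq_iff trace_ext_def interior_trace_def \<mu>_def W_def)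
  have vec_eq: "trace_int_vec \<Omega> F U = componentwise (trace_int \<Omega> F U)"
    "trace_ext_vec \<Omega> F U = componentwise (trace_ext \<Omega> F U)"
    by (simp_all add: fun_eq_iff trace_int_vec_def trace_ext_vec_def componentwise_def)
  have zero: "interior_trace \<Omega> F \<mu> S \<phi> = 0"
    if "S = U \<or> S = W" "\<phi> \<in> test_functions U \<or> \<phi> \<in> test_functions W" for S \<phi>
  proof -
    have "\<phi> \<in> test_functions S \<or> supp \<phi> \<inter> S = {}"
      using that UW test_functionsD(3)[of \<phi> U] test_functionsD(3)[of \<phi> W] by blast
    moreover have "S \<subseteq> \<Omega>" using that U W by blast
    ultimately show ?thesis using interior_trace_inside[OF curl] interior_trace_outside by blast
  qed
  have lin: "linear_on_tests \<Omega> (trace_int \<Omega> F U)" "linear_on_tests \<Omega> (trace_ext \<Omega> F U)"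
    unfolding int_eq ext_eq
    by (intro linear_on_tests_uminus linear_on_tests_interior_trace[OF \<open>open \<Omega>\<close> \<open>1 \<le> p\<close> F \<mu>] U W)+
  have ord: "order_at_most \<Omega> (trace_int \<Omega> F U) 1" "order_at_most \<Omega> (trace_ext \<Omega> F U) 1"
    using order_at_most_interior_trace[OF \<open>open \<Omega>\<close> \<open>1 \<le> p\<close> F \<mu> U]
      order_at_most_interior_trace[OF \<open>open \<Omega>\<close> \<open>1 \<le> p\<close> F \<mu> W]
    unfolding int_eq ext_eq by (simp_all add: order_at_most_def)
  have supp: "dist_support \<Omega> (trace_int \<Omega> F U) \<subseteq> frontier U" "dist_support \<Omega> (trace_ext \<Omega> F U) \<subseteq> frontier U"
    unfolding int_eq ext_eq frontier[symmetric]
    using zero by (intro dist_support_subset U W; simp)+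
  have "distribution \<Omega> T \<and> dist_support \<Omega> T \<subseteq> frontier U \<and> order_at_most \<Omega> T 1 \<and>
      distribution \<Omega> (componentwise T) \<and> dist_support \<Omega> (componentwise T) \<subseteq> frontier U \<and>
      order_at_most \<Omega> (componentwise T) 1"
    if "linear_on_tests \<Omega> T" "order_at_most \<Omega> T 1" "dist_support \<Omega> T \<subseteq> frontier U" for T
    using that order_at_most_componentwise[OF that(2)] dist_support_componentwise[of \<Omega> T]
      distribution_if_order_at_most[OF that(1,2)]
      distribution_if_order_at_most[OF linear_on_tests_componentwise[OF that(1)] order_at_most_componentwise[OF that(2)]]
    by (intro conjI) (assumption | rule subset_trans)+
  from this[OF lin(1) ord(1) supp(1)] this[OF lin(2) ord(2) supp(2)]
  show ?thesis unfolding vec_eq by blast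
qed

end
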